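(* There is a function $r$ defined on the integers $n \ge 6$ that are not perfect squares, with $r(n) \ge 1$ and $r(n) \to 1$ as $n \to \infty$, with the following property. For every integer $n \ge 6$ that is not a perfect square, some square can be tiled by exactly $n$ smaller squares that have exactly two different side lengths, and the ratio of the larger side length to the smaller one is $r(n)$.
   Context: A tiling (decomposition) of a square $S$ by squares is a finite collection of squares with pairwise disjoint interiors whose union is $S$. *)

theory Defs
  imports "HOL-Analysis.Analysis" "HOL-Computational_Algebra.Nth_Powers"
begin

text \<open>
  Squares are closed, nondegenerate and in arbitrary position: the corner \<open>p\<close> and the two
  orthogonal edge vectors \<open>u\<close>, \<open>v\<close> of length \<open>s\<close> need not be parallel to the axes.
\<close>

definition plane_square :: "real \<Rightarrow> (real \<times> real) set \<Rightarrow> bool" where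
  "plane_square s S \<longleftrightarrow> s > 0 \<and>
     (\<exists>p u v. norm u = s \<and> norm v = s \<and> u \<bullet> v = 0 \<and>
        S = {p + a *\<^sub>R u + b *\<^sub>R v | a b. a \<in> {0..1} \<and> b \<in> {0..1}})"

definition square_tiling :: "(real \<times> real) set set \<Rightarrow> (real \<times> real) set \<Rightarrow> bool" where
  "square_tiling \<T> S \<longleftrightarrow> finite \<T> \<and> (\<forall>T\<in>\<T>. \<exists>s. plane_square s T) \<and>
     pairwise (\<lambda>T U. interior T \<inter> interior U = {}) \<T> \<and> \<Union>\<T> = S"

definition side_lengths :: "(real \<times> real) set set \<Rightarrow> real set" where
  "side_lengths \<T> = {s. \<exists>T\<in>\<T>. plane_square s T}"

end

theory Submission
  imports Defs
begin

text \<open>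
  Cut a square of side \<open>x A\<close> into \<open>x\<^sup>2\<close> squares of side \<open>A\<close> and replace a corner block of
  \<open>j B \<times> B\<close> of them, which measures \<open>j A B \<times> A B\<close>, by \<open>j A \<times> A\<close> squares of side \<open>B\<close>.
  This uses \<open>x\<^sup>2 - j B\<^sup>2 + j A\<^sup>2\<close> squares. It remains to write \<open>n\<close> in this form with
  \<open>\<bar>A - B\<bar> \<le> 2\<close> and \<open>A\<close>, \<open>B\<close> of order \<open>\<surd>n\<close>. Every odd number is a difference of consecutive
  squares, so \<open>j = 1\<close> and the nearest square \<open>x\<^sup>2\<close> below or above \<open>n\<close> with \<open>x\<^sup>2 - n\<close> odd will do,
  unless \<open>n\<close> is too close to that square. In that case the neighbouring square on the other
  side of \<open>n\<close> differs from \<open>n\<close> by \<open>2 q\<close> with \<open>q\<close> of order \<open>\<surd>n\<close>, and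
  \<open>2 (2 a + 1) = 2 ((a + 1)\<^sup>2 - a\<^sup>2)\<close>, \<open>4 w = (w + 1)\<^sup>2 - (w - 1)\<^sup>2\<close> handle odd and even \<open>q\<close>.
  Only \<open>n = 8 = 4\<^sup>2 - 3\<^sup>2 + 1\<^sup>2\<close> escapes this scheme.
\<close>

section \<open>Uniqueness of the side of a square\<close>

text \<open>The diagonal from \<open>p\<close> to \<open>p + u + v\<close> has squared length
  \<open>2 * s\<^sup>2\<close>. Both its ends have coordinates in \<open>{0..1}\<close> along
  \<open>w\<close> and \<open>z\<close>, so this is at most \<open>2 * t\<^sup>2\<close>. By
  symmetry a set has only one side, which makes \<open>side_lengths\<close> meaningful.\<close>

lemma plane_square_side_le:
  assumes "plane_square s S" "plane_square t S"
  shows "s \<le> t"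
proof -
  obtain p u v where s: "s > 0" "norm u = s" "norm v = s" "u \<bullet> v = 0"
    and S: "S = {p + a *\<^sub>R u + b *\<^sub>R v | a b. a \<in> {0..1} \<and> b \<in> {0..1}}"
    using assms(1) unfolding plane_square_def by blast
  obtain q w z where t: "t > 0" "norm w = t" "norm z = t" "w \<bullet> z = 0"
    and S': "S = {q + a *\<^sub>R w + b *\<^sub>R z | a b. a \<in> {0..1} \<and> b \<in> {0..1}}"
    using assms(2) unfolding plane_square_def by blast
  have norm2: "(norm (a *\<^sub>R w + b *\<^sub>R z))\<^sup>2 = (a\<^sup>2 + b\<^sup>2) * t\<^sup>2" for a b
  proof -
    have "(norm (a *\<^sub>R w + b *\<^sub>R z))\<^sup>2 = a\<^sup>2 * (norm w)\<^sup>2 + b\<^sup>2 * (norm z)\<^sup>2"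
      unfolding power2_norm_eq_inner using t(4)
      by (simp add: inner_add_left inner_add_right inner_commute[of z w] power2_eq_square)
    then show ?thesis using t by (simp add: algebra_simps)
  qed
  have "p \<in> S" unfolding S by (intro CollectI exI[of _ "0::real"]) simp
  moreover have "p + u + v \<in> S" unfolding S by (intro CollectI exI[of _ "1::real"]) simp
  ultimately obtain a b c d where ab: "a \<in> {0..1}" "b \<in> {0..1}" "c \<in> {0..1}" "d \<in> {0..1}"
    and p: "p = q + a *\<^sub>R w + b *\<^sub>R z" and puv: "p + u + v = q + c *\<^sub>R w + d *\<^sub>R z"
    unfolding S' by blast
  have "u + v = (p + u + v) - p" by simp
  also have "\<dots> = (c - a) *\<^sub>R w + (d - b) *\<^sub>R z"
    unfolding puv by (subst p) (simp add: algebra_simps)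
  finally have "(norm (u + v))\<^sup>2 = ((c - a)\<^sup>2 + (d - b)\<^sup>2) * t\<^sup>2"
    using norm2 by simp
  moreover have "(norm (u + v))\<^sup>2 = 2 * s\<^sup>2"
    using norm_add_Pythagorean[of u v] s(2-4) by (simp add: orthogonal_def)
  moreover have "(c - a)\<^sup>2 \<le> 1" "(d - b)\<^sup>2 \<le> 1"
    using ab by (simp_all add: abs_square_le_1 abs_le_iff)
  then have "((c - a)\<^sup>2 + (d - b)\<^sup>2) * t\<^sup>2 \<le> 2 * t\<^sup>2"
    by (intro mult_right_mono) auto
  ultimately have "s\<^sup>2 \<le> t\<^sup>2" by simp
  then show ?thesis using t(1) power2_le_imp_le[of s t] by simp
qed

lemma plane_square_side_unique:
  "plane_square s S \<Longrightarrow> plane_square t S \<Longrightarrow> s = t"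
  by (meson antisym plane_square_side_le)

lemma plane_square_Times:
  assumes "s > 0"
  shows "plane_square s ({x..x + s} \<times> {y..y + s})"
proof -
  have "{x..x + s} \<times> {y..y + s} =
      {(x, y) + a *\<^sub>R (s, 0) + b *\<^sub>R (0, s) | a b. a \<in> {0..1} \<and> b \<in> {0..1}}" (is "?L = ?R")
  proof (intro equalityI subsetI)
    fix P assume "P \<in> ?L"
    then obtain X Y where P: "P = (X, Y)" "x \<le> X" "X \<le> x + s" "y \<le> Y" "Y \<le> y + s" by auto
    then have "P = (x, y) + ((X - x) / s) *\<^sub>R (s, 0) + ((Y - y) / s) *\<^sub>R (0, s)"
      "(X - x) / s \<in> {0..1}" "(Y - y) / s \<in> {0..1}"
      using assms by (auto simp: field_simps)
    then show "P \<in> ?R" by blast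
  next
    fix P assume "P \<in> ?R"
    then obtain a b where "P = (x + a * s, y + b * s)" "0 \<le> a" "a \<le> 1" "0 \<le> b" "b \<le> 1" by auto
    then show "P \<in> ?L" using assms by (auto simp: mult_left_le_one_le)
  qed
  moreover have "norm (s, 0::real) = s" "norm (0::real, s) = s" "(s, 0::real) \<bullet> (0, s) = 0"
    using assms by (simp_all add: norm_Pair)
  ultimately show ?thesis
    unfolding plane_square_def using assms by blast
qed

section \<open>Grids of axis-parallel squares\<close>

text \<open>Cells are indexed by natural numbers, so that disjointness, containment and counting
  reduce to statements about \<open>nat\<close>.\<close>

definition grid_square :: "nat \<Rightarrow> nat \<times> nat \<Rightarrow> (real \<times> real) set" where
  "grid_square s c =
     {real (s * fst c)..real (s * fst c) + real s} \<times> {real (s * snd c)..real (s * snd c) + real s}"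

lemma plane_square_grid_square: "s > 0 \<Longrightarrow> plane_square (real s) (grid_square s c)"
  unfolding grid_square_def by (rule plane_square_Times) simp

lemma interior_grid_square:
  "interior (grid_square s c) =
     {real (s * fst c)<..<real (s * fst c) + real s} \<times> {real (s * snd c)<..<real (s * snd c) + real s}"
  unfolding grid_square_def by (simp add: interior_Times)

lemma open_grid_intervals_index_unique:
  fixes t :: real
  assumes "real (s * i) < t" "t < real (s * i) + real s"
    and "real (s * k) < t" "t < real (s * k) + real s"
  shows "i = k"
proof -
  have "s * i < s * (k + 1)" "s * k < s * (i + 1)"
    using assms unfolding of_nat_less_iff[where 'a = real, symmetric] by (simp_all add: algebra_simps)
  then show ?thesis by (simp only: mult_less_cancel1) linarith
qed

lemma interior_grid_squares_disjoint:
  assumes "c \<noteq> d"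
  shows "interior (grid_square s c) \<inter> interior (grid_square s d) = {}"
proof (rule ccontr)
  assume "interior (grid_square s c) \<inter> interior (grid_square s d) \<noteq> {}"
  then obtain P where "P \<in> interior (grid_square s c)" "P \<in> interior (grid_square s d)" by blast
  then have "fst c = fst d" "snd c = snd d"
    unfolding interior_grid_square
    using open_grid_intervals_index_unique[of s "fst c" "fst P" "fst d"]
      open_grid_intervals_index_unique[of s "snd c" "snd P" "snd d"]
    by (simp_all add: mem_Times_iff)
  then show False using assms by (simp add: prod_eq_iff)
qed

text \<open>If two cells coincided, their common interior would be disjoint from itself, hence
  empty. Injectivity lets tiles be counted by their indices.\<close>

lemma inj_grid_square:
  assumes "s > 0"
  shows "inj (grid_square s)"
proof (rule injI, rule ccontr)
  fix c d assume eq: "grid_square s c = grid_square s d" and "c \<noteq> d"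
  then have "interior (grid_square s c) = {}"
    using interior_grid_squares_disjoint[of c d s] by simp
  then show False using assms by (auto simp: interior_grid_square)
qed

text \<open>Induction on \<open>N\<close>: either an earlier cell contains \<open>t\<close> or the
  last one does. A nonzero start \<open>M\<close> serves the region beyond the replaced
  block.\<close>

lemma grid_interval_cover:
  fixes t :: real
  assumes "s > 0" "M < N" "real (s * M) \<le> t" "t \<le> real (s * N)"
  shows "\<exists>i\<ge>M. i < N \<and> real (s * i) \<le> t \<and> t \<le> real (s * i) + real s"
  using assms(2,4)
proof (induction N)
  case (Suc N)
  show ?case
  proof (cases "M < N \<and> t \<le> real (s * N)")
    case True
    then show ?thesis using Suc.IH by (meson less_SucI)
  next
    case False
    then have "real (s * N) \<le> t" using Suc.prems assms(3) by (cases "M = N") auto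
    then show ?thesis using Suc.prems by (intro exI[of _ N]) (auto simp: algebra_simps)
  qed
qed simp

section \<open>Tilings with two sizes of squares\<close>

text \<open>\<open>I\<close> indexes the cells of side \<open>A\<close> outside the block,
  \<open>J\<close> the cells of side \<open>B\<close> filling it. The pieces fit because the block
  has the same outline in both grids: \<open>A * (j * B) = B * (j * A)\<close> by
  \<open>A * B\<close>. Either of \<open>A\<close>, \<open>B\<close> may be the larger.\<close>

lemma two_size_tiling:
  fixes A B j x :: nat
  assumes pos: "A > 0" "B > 0" "j > 0" and "A \<noteq> B" "j * B \<le> x" "B < x"
  shows "\<exists>S L \<T>. plane_square L S \<and> square_tiling \<T> S \<and> card \<T> = x\<^sup>2 - j * B\<^sup>2 + j * A\<^sup>2 \<and>
           (\<forall>s \<in> side_lengths \<T>. s < L) \<and> side_lengths \<T> = {real A, real B}"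
proof -
  define I where "I = {..<x} \<times> {..<x} - {..<j * B} \<times> {..<B}"
  define J where "J = {..<j * A} \<times> {..<A}"
  define \<T> where "\<T> = grid_square A ` I \<union> grid_square B ` J"
  define S where "S = {0..real (A * x)} \<times> {0..real (A * x)}"
  have fin: "finite I" "finite J" by (auto simp: I_def J_def)
  \<comment> \<open>The cell just above the block survives because \<open>B < x\<close>, even if
    \<open>j * B = x\<close>; so side \<open>A\<close> really occurs.\<close>
  have "(0, B) \<in> I" using assms by (auto simp: I_def)
  have "(0, 0) \<in> J" using pos by (auto simp: J_def)
  have sides: "plane_square s (grid_square A c) \<longleftrightarrow> s = A" "plane_square s (grid_square B c) \<longleftrightarrow> s = B"
    for s c
    using plane_square_side_unique plane_square_grid_square pos by blast+
  have "side_lengths \<T> = {s. I \<noteq> {} \<and> s = A \<or> J \<noteq> {} \<and> s = B}"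
    unfolding side_lengths_def \<T>_def bex_Un bex_simps sides by blast
  then have lengths: "side_lengths \<T> = {real A, real B}"
    using \<open>(0, B) \<in> I\<close> \<open>(0, 0) \<in> J\<close> by blast
  have mixed: "interior (grid_square A c) \<inter> interior (grid_square B d) = {}"
    if "c \<in> I" "d \<in> J" for c d
  proof -
    \<comment> \<open>The cell \<open>d\<close> ends inside the block, while \<open>c\<close> starts
      at or beyond its right or upper edge.\<close>
    have "B * (fst d + 1) \<le> B * (j * A)" "B * (snd d + 1) \<le> B * A"
      using that(2) by (intro mult_left_mono; auto simp: J_def)+
    then have "B * fst d + B \<le> A * (j * B)" "B * snd d + B \<le> A * B"
      by (simp_all add: algebra_simps)
    moreover have "A * (j * B) \<le> A * fst c \<or> A * B \<le> A * snd c"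
      using that(1) by (auto simp: I_def)
    ultimately have "B * fst d + B \<le> A * fst c \<or> B * snd d + B \<le> A * snd c"
      using le_trans by blast
    then have "real (B * fst d) + real B \<le> real (A * fst c) \<or>
        real (B * snd d) + real B \<le> real (A * snd c)"
      by (simp only: of_nat_add[symmetric] of_nat_le_iff)
    then show ?thesis unfolding interior_grid_square by auto
  qed
  have "pairwise (\<lambda>T U. interior T \<inter> interior U = {}) \<T>"
  proof (rule pairwiseI)
    fix T U assume "T \<in> \<T>" "U \<in> \<T>" "T \<noteq> U"
    have same: "interior T \<inter> interior U = {}"
      if "T = grid_square s c" "U = grid_square s d" for s c d
      using \<open>T \<noteq> U\<close> that interior_grid_squares_disjoint[of c d s] by auto
    from \<open>T \<in> \<T>\<close> \<open>U \<in> \<T>\<close> show "interior T \<inter> interior U = {}"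
      unfolding \<T>_def
    proof (elim UnE imageE)
      fix c d assume "T = grid_square B d" "U = grid_square A c" "c \<in> I" "d \<in> J"
      then show ?thesis using mixed[of c d] by (simp add: Int_commute)
    qed (use same mixed in simp_all)
  qed
  moreover have "\<Union>\<T> = S"
  proof (intro equalityI subsetI)
    fix P assume "P \<in> \<Union>\<T>"
    then consider c where "c \<in> I" "P \<in> grid_square A c" | d where "d \<in> J" "P \<in> grid_square B d"
      unfolding \<T>_def by auto
    then show "P \<in> S"
    proof cases
      case 1
      then have "A * (fst c + 1) \<le> A * x" "A * (snd c + 1) \<le> A * x"
        by (intro mult_left_mono; auto simp: I_def)+
      then have "real (A * fst c) + real A \<le> real (A * x)" "real (A * snd c) + real A \<le> real (A * x)"
        unfolding of_nat_add[symmetric] of_nat_le_iff by simp_all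
      moreover have "0 \<le> real (A * fst c)" "0 \<le> real (A * snd c)" by simp_all
      ultimately show ?thesis using 1(2) unfolding grid_square_def S_def
        by (auto simp del: of_nat_mult)
    next
      case 2
      then have "B * (fst d + 1) \<le> B * (j * A)" "B * (snd d + 1) \<le> B * A"
        by (intro mult_left_mono; auto simp: J_def)+
      moreover have "B * (j * A) \<le> A * x" "B * A \<le> A * x"
        using assms mult_le_mono2[of "j * B" x A] by (auto simp: ac_simps)
      ultimately have "B * (fst d + 1) \<le> A * x" "B * (snd d + 1) \<le> A * x"
        by linarith+
      then have "real (B * fst d) + real B \<le> real (A * x)" "real (B * snd d) + real B \<le> real (A * x)"
        unfolding of_nat_add[symmetric] of_nat_le_iff by simp_all
      moreover have "0 \<le> real (B * fst d)" "0 \<le> real (B * snd d)" by simp_all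
      ultimately show ?thesis using 2(2) unfolding grid_square_def S_def
        by (auto simp del: of_nat_mult)
    qed
  next
    fix P assume "P \<in> S"
    then obtain X Y where P: "P = (X, Y)" and XY: "0 \<le> X" "X \<le> real (A * x)" "0 \<le> Y" "Y \<le> real (A * x)"
      unfolding S_def by auto
    have x0: "0 < x" using assms by simp
    consider "X \<le> real (B * (j * A))" "Y \<le> real (B * A)"
      | "real (A * (j * B)) < X" | "real (A * B) < Y"
      by (force simp: ac_simps)
    then show "P \<in> \<Union>\<T>"
    proof cases
      case 1
      obtain i where "i < j * A" "real (B * i) \<le> X" "X \<le> real (B * i) + real B"
        using grid_interval_cover[of B 0 "j * A" X] 1 XY pos by auto
      moreover obtain l where "l < A" "real (B * l) \<le> Y" "Y \<le> real (B * l) + real B"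
        using grid_interval_cover[of B 0 A Y] 1 XY pos by auto
      ultimately have "(i, l) \<in> J" "P \<in> grid_square B (i, l)"
        by (auto simp: J_def P grid_square_def)
      then show ?thesis by (auto simp: \<T>_def)
    next
      case 2
      \<comment> \<open>A point strictly to the right of the block shows that the block does not
        span the full width, so there is a column to search.\<close>
      have "real (A * (j * B)) < real (A * x)" using 2 XY by linarith
      then have "j * B < x" by (simp only: of_nat_less_iff) simp
      then obtain i where "j * B \<le> i" "i < x" "real (A * i) \<le> X" "X \<le> real (A * i) + real A"
        using grid_interval_cover[of A "j * B" x X] 2 XY pos by auto
      moreover obtain l where "l < x" "real (A * l) \<le> Y" "Y \<le> real (A * l) + real A"
        using grid_interval_cover[of A 0 x Y] XY pos x0 by auto
      ultimately have "(i, l) \<in> I" "P \<in> grid_square A (i, l)"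
        by (auto simp: I_def P grid_square_def)
      then show ?thesis by (auto simp: \<T>_def)
    next
      case 3
      obtain l where "B \<le> l" "l < x" "real (A * l) \<le> Y" "Y \<le> real (A * l) + real A"
        using grid_interval_cover[of A B x Y] 3 XY pos \<open>B < x\<close> by auto
      moreover obtain i where "i < x" "real (A * i) \<le> X" "X \<le> real (A * i) + real A"
        using grid_interval_cover[of A 0 x X] XY pos x0 by auto
      ultimately have "(i, l) \<in> I" "P \<in> grid_square A (i, l)"
        by (auto simp: I_def P grid_square_def)
      then show ?thesis by (auto simp: \<T>_def)
    qed
  qed
  ultimately have "square_tiling \<T> S"
    unfolding square_tiling_def using fin plane_square_grid_square pos
    by (auto simp: \<T>_def)
  moreover have "card \<T> = x\<^sup>2 - j * B\<^sup>2 + j * A\<^sup>2"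
  proof -
    have "grid_square A c \<noteq> grid_square B d" for c d
      using sides \<open>A \<noteq> B\<close> by (metis of_nat_eq_iff)
    then have "card \<T> = card (grid_square A ` I) + card (grid_square B ` J)"
      unfolding \<T>_def using fin by (intro card_Un_disjoint) auto
    also have "card (grid_square A ` I) = card I"
      by (rule card_image[OF inj_on_subset[OF inj_grid_square[OF pos(1)] subset_UNIV]])
    also have "card (grid_square B ` J) = card J"
      by (rule card_image[OF inj_on_subset[OF inj_grid_square[OF pos(2)] subset_UNIV]])
    also have "card I = x\<^sup>2 - j * B\<^sup>2"
      unfolding I_def using assms
      by (subst card_Diff_subset) (auto simp: card_cartesian_product power2_eq_square)
    also have "card J = j * A\<^sup>2"
      by (simp add: J_def card_cartesian_product power2_eq_square)
    finally show ?thesis .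
  qed
  moreover have "plane_square (real (A * x)) S"
    using plane_square_Times[of "real (A * x)" 0 0] assms by (simp add: S_def)
  moreover have "\<forall>s \<in> side_lengths \<T>. s < real (A * x)"
  proof -
    have "1 < x" "x \<le> A * x" using assms by auto
    then have "A < A * x" "B < A * x" using \<open>A > 0\<close> \<open>B < x\<close> by (simp, linarith)
    then show ?thesis unfolding lengths by (auto simp del: of_nat_mult)
  qed
  ultimately show ?thesis using lengths by blast
qed

section \<open>Nonsquares as tile counts\<close>

text \<open>The arithmetic side of \<open>two_size_tiling\<close>. The order matters:
  \<open>A\<close> is the side of the cells kept, \<open>B\<close> that of the cells put into the
  block.\<close>

definition tiling_count :: "nat \<Rightarrow> nat \<Rightarrow> nat \<Rightarrow> bool" where
  "tiling_count n A B \<longleftrightarrow> (\<exists>j x. j > 0 \<and> j * B \<le> x \<and> B < x \<and> n = x\<^sup>2 - j * B\<^sup>2 + j * A\<^sup>2)"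

text \<open>The additive equation avoids truncated subtraction;
  \<open>j * B\<^sup>2 \<le> x\<^sup>2\<close> comes from multiplying \<open>j * B \<le> x\<close>
  by \<open>B \<le> x\<close>.\<close>

lemma tiling_countI:
  assumes "j > 0" "j * B \<le> x" "B < x" "n + j * B\<^sup>2 = x\<^sup>2 + j * A\<^sup>2"
  shows "tiling_count n A B"
proof -
  have "j * B * B \<le> x * x" using assms by (intro mult_mono) auto
  then have "j * B\<^sup>2 \<le> x\<^sup>2" by (simp add: power2_eq_square)
  then show ?thesis unfolding tiling_count_def using assms by (intro exI[of _ j] exI[of _ x]) auto
qed

text \<open>The bound \<open>n \<le> (8 * a)\<^sup>2\<close> makes \<open>a\<close> grow like the
  square root of \<open>n\<close>, so that a difference of at most 2 forces \<open>b / a\<close>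
  towards 1.\<close>

lemma nonsquare_tiling_count:
  fixes n :: nat
  assumes "6 \<le> n" "\<not> is_square n"
  shows "\<exists>a b. 0 < a \<and> a < b \<and> b \<le> a + 2 \<and> n \<le> (8 * a)\<^sup>2 \<and> (tiling_count n a b \<or> tiling_count n b a)"
proof -
  define k where "k = floor_sqrt n"
  define e where "e = n - k\<^sup>2"
  have n: "n = k\<^sup>2 + e" unfolding e_def k_def by simp
  have lt: "n < (k + 1)\<^sup>2" unfolding k_def using Suc_floor_sqrt_power2_gt by simp
  have "e \<noteq> 0" using assms(2) n by (cases e) simp_all
  have e2k: "e \<le> 2 * k" using lt n by (simp add: power2_eq_square)
  have k2: "2 \<le> k"
  proof (rule ccontr)
    assume "\<not> 2 \<le> k"
    then have "k \<in> {0, 1}" by auto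
    then show False using assms(1) lt by (auto simp: power2_eq_square)
  qed
  \<comment> \<open>The factor 8 is generous: every use below has \<open>k \<le> 4 * a + 2\<close>,
    hence \<open>k + 1 \<le> 4 * a + 3 \<le> 8 * a\<close>.\<close>
  have witness: ?thesis
    if "0 < a" "a < b" "b \<le> a + 2" "k + 1 \<le> 8 * a" "tiling_count n a b \<or> tiling_count n b a" for a b
  proof -
    have "n \<le> (8 * a)\<^sup>2" using lt power_mono[OF that(4), of 2] by linarith
    then show ?thesis using that by blast
  qed
  show ?thesis
  proof (cases "odd e")
    case True
    show ?thesis
    proof (cases "k \<le> e")
      case True
      from \<open>odd e\<close> obtain m where m: "e = 2 * m + 1" by (auto elim: oddE)
      have "tiling_count n (m + 1) m"
        using e2k m n by (intro tiling_countI[of 1 _ k]) (auto simp: power2_eq_square algebra_simps)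
      then show ?thesis using m True k2 by (intro witness[of m "m + 1"]) auto
    next
      case False
      from \<open>odd e\<close> obtain m where m: "e = 2 * m + 1" by (auto elim: oddE)
      \<comment> \<open>Now \<open>(k + 1)\<^sup>2 - n = 2 * q\<close>, and \<open>e < k\<close>
        makes \<open>q\<close> more than half of \<open>k\<close>.\<close>
      define q where "q = k - m"
      have k: "k = q + m" "m + 2 \<le> q" using False m by (auto simp: q_def)
      \<comment> \<open>The only smaller possibility is \<open>n = 5\<close>, excluded by
        \<open>6 \<le> n\<close>. The bound keeps \<open>a\<close> positive below.\<close>
      have k3: "3 \<le> q"
      proof (rule ccontr)
        assume "\<not> 3 \<le> q"
        then have "m = 0" "q = 2" using k by auto
        then show False using assms(1) n m k by (simp add: power2_eq_square)
      qed
      show ?thesis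
      proof (cases "odd q")
        case True
        then obtain a where a: "q = 2 * a + 1" by (auto elim: oddE)
        \<comment> \<open>A block with \<open>j = 2\<close> fits since
          \<open>2 * (a + 1) = q + 1 \<le> k + 1\<close>.\<close>
        have "tiling_count n a (a + 1)"
          using a k m n
          by (intro tiling_countI[of 2 _ "k + 1"]) (auto simp: power2_eq_square algebra_simps)
        then show ?thesis using a k k3
          by (intro witness[of a "a + 1"]) auto
      next
        case False
        then obtain w where w: "q = 2 * w" by (auto elim: evenE)
        obtain a where a: "w = a + 1" using w k3 by (cases w) auto
        have "tiling_count n a (a + 2)"
          using a w k m n
          by (intro tiling_countI[of 1 _ "k + 1"]) (auto simp: power2_eq_square algebra_simps)
        then show ?thesis using a w k k3
          by (intro witness[of a "a + 2"]) auto
      qed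
    qed
  next
    case False
    then obtain q where q: "e = 2 * q" by (auto elim: evenE)
    define m where "m = k - q"
    have k: "k = q + m" using q e2k by (simp add: m_def)
    have q0: "0 < q" using q \<open>e \<noteq> 0\<close> by simp
    show ?thesis
    \<comment> \<open>Here \<open>n - k\<^sup>2 = 2 * q\<close> and
      \<open>(k + 1)\<^sup>2 - n = 2 * m + 1\<close>. The odd gap above is used if it is large
      enough; otherwise \<open>q\<close> exceeds half of \<open>k\<close> and the gap below is
      used.\<close>
    proof (cases "k \<le> 2 * m + 1")
      case True
      have "tiling_count n m (m + 1)"
        using q n k q0
        by (intro tiling_countI[of 1 _ "k + 1"]) (auto simp: power2_eq_square algebra_simps)
      then show ?thesis using True k2
        by (intro witness[of m "m + 1"]) auto
    next
      case large: False
      show ?thesis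
      proof (cases "k = 2")
        case True
        \<comment> \<open>Here \<open>q = 2\<close>, for which the even case below would give the
          degenerate side \<open>a = 0\<close>.\<close>
        then have "n = 8" using large k q n by (auto simp: power2_eq_square)
        then have "tiling_count n 1 3"
          by (intro tiling_countI[of 1 _ 4]) (auto simp: power2_eq_square)
        then show ?thesis using \<open>n = 8\<close>
          by (intro exI[of _ 1] exI[of _ 3]) simp
      next
        case False
        then have q3: "3 \<le> q" using k2 large k by auto
        show ?thesis
        proof (cases "odd q")
          case True
          then obtain a where a: "q = 2 * a + 1" by (auto elim: oddE)
          have "tiling_count n (a + 1) a"
            using a k q n
            by (intro tiling_countI[of 2 _ k]) (auto simp: power2_eq_square algebra_simps)
          then show ?thesis using a k q3 large
            by (intro witness[of a "a + 1"]) auto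
        next
          case False
          then obtain w where w: "q = 2 * w" by (auto elim: evenE)
          obtain a where a: "w = a + 1" using w q3 by (cases w) auto
          have "tiling_count n (a + 2) a"
            using a w k q n
            by (intro tiling_countI[of 1 _ k]) (auto simp: power2_eq_square algebra_simps)
          then show ?thesis using a w k q3 large
            by (intro witness[of a "a + 2"]) auto
        qed
      qed
    qed
  qed
qed

section \<open>The side ratio and its limit\<close>

lemma tiling_count_imp_tiling:
  assumes "tiling_count n A B" "A > 0" "B > 0" "A \<noteq> B"
  shows "\<exists>S L \<T>. plane_square L S \<and> square_tiling \<T> S \<and> card \<T> = n \<and>
           (\<forall>s \<in> side_lengths \<T>. s < L) \<and> side_lengths \<T> = {real A, real B}"
proof -
  obtain j x where "j > 0" "j * B \<le> x" "B < x" "n = x\<^sup>2 - j * B\<^sup>2 + j * A\<^sup>2"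
    using assms(1) unfolding tiling_count_def by auto
  then show ?thesis using two_size_tiling[of A B j x] assms by simp
qed

text \<open>From \<open>b \<le> a + 2\<close> and \<open>sqrt n \<le> 8 * a\<close> follows
  \<open>b / a \<le> 1 + 2 / a \<le> 1 + 16 / sqrt n\<close>.\<close>

lemma nonsquare_tiling:
  fixes n :: nat
  assumes "6 \<le> n" "\<not> is_square n"
  shows "\<exists>a b :: nat. 0 < a \<and> a < b \<and> real b / real a \<le> 1 + 16 / sqrt n \<and>
           (\<exists>S L \<T>. plane_square L S \<and> square_tiling \<T> S \<and> card \<T> = n \<and>
              (\<forall>s \<in> side_lengths \<T>. s < L) \<and> side_lengths \<T> = {real a, real b})"
proof -
  obtain a b where ab: "0 < a" "a < b" "b \<le> a + 2" "n \<le> (8 * a)\<^sup>2"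
    and count: "tiling_count n a b \<or> tiling_count n b a"
    using nonsquare_tiling_count[OF assms] by blast
  have "real n \<le> (8 * real a)\<^sup>2" using ab(4) by (metis of_nat_le_iff of_nat_mult of_nat_numeral of_nat_power)
  then have "sqrt n \<le> 8 * real a" by (intro real_le_lsqrt) auto
  moreover have "sqrt n > 0" using assms(1) by simp
  ultimately have "2 / real a \<le> 16 / sqrt n" using ab(1) by (simp add: field_simps)
  moreover have "real b / real a \<le> (real a + 2) / real a"
    using ab(1,3) by (intro divide_right_mono) auto
  then have "real b / real a \<le> 1 + 2 / real a" using ab(1) by (simp add: add_divide_distrib)
  ultimately have "real b / real a \<le> 1 + 16 / sqrt n" by linarith
  moreover have "\<exists>S L \<T>. plane_square L S \<and> square_tiling \<T> S \<and> card \<T> = n \<and>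
      (\<forall>s \<in> side_lengths \<T>. s < L) \<and> side_lengths \<T> = {real a, real b}"
    using count
  proof
    assume "tiling_count n a b"
    then show ?thesis using tiling_count_imp_tiling[of n a b] ab by auto
  next
    assume "tiling_count n b a"
    then show ?thesis using tiling_count_imp_tiling[of n b a] ab by (simp add: insert_commute)
  qed
  ultimately show ?thesis using ab by blast
qed

theorem theorem1:
  shows "\<exists>r :: nat \<Rightarrow> real.
    (\<forall>n. 6 \<le> n \<and> \<not> is_square n \<longrightarrow> r n \<ge> 1) \<and>
    (r \<longlongrightarrow> 1) (inf sequentially (principal {n. 6 \<le> n \<and> \<not> is_square n})) \<and>
    (\<forall>n. 6 \<le> n \<and> \<not> is_square n \<longrightarrow>
      (\<exists>S L \<T>. plane_square L S \<and> square_tiling \<T> S \<and> card \<T> = n \<and>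
        (\<forall>s \<in> side_lengths \<T>. s < L) \<and>
        (\<exists>a b. a < b \<and> side_lengths \<T> = {a, b} \<and> b / a = r n)))"
proof -
  \<comment> \<open>With the premises inside the existential, \<open>a\<close> and \<open>b\<close>
    become total functions of \<open>n\<close>, arbitrary where \<open>n\<close> is not admissible.
    The limit is therefore taken along \<open>?F\<close>, where \<open>r\<close> lies between 1 and
    \<open>1 + 16 / sqrt n\<close>.\<close>
  have "\<forall>n::nat. \<exists>a b :: nat. 6 \<le> n \<and> \<not> is_square n \<longrightarrow>
      0 < a \<and> a < b \<and> real b / real a \<le> 1 + 16 / sqrt n \<and>
      (\<exists>S L \<T>. plane_square L S \<and> square_tiling \<T> S \<and> card \<T> = n \<and>
         (\<forall>s \<in> side_lengths \<T>. s < L) \<and> side_lengths \<T> = {real a, real b})"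
    using nonsquare_tiling by meson
  then obtain a b :: "nat \<Rightarrow> nat" where ab: "\<And>n. 6 \<le> n \<Longrightarrow> \<not> is_square n \<Longrightarrow>
      0 < a n \<and> a n < b n \<and> real (b n) / real (a n) \<le> 1 + 16 / sqrt n \<and>
      (\<exists>S L \<T>. plane_square L S \<and> square_tiling \<T> S \<and> card \<T> = n \<and>
         (\<forall>s \<in> side_lengths \<T>. s < L) \<and> side_lengths \<T> = {real (a n), real (b n)})"
    by metis
  define r where "r n = real (b n) / real (a n)" for n
  let ?F = "inf sequentially (principal {n. 6 \<le> n \<and> \<not> is_square n})"
  have ge: "r n \<ge> 1" if "6 \<le> n" "\<not> is_square n" for n
    using ab[OF that] by (simp add: r_def)
  have "(\<lambda>n. 1 + 16 / sqrt (real n)) \<longlonglongrightarrow> 1 + 0"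
    by (intro tendsto_intros real_tendsto_divide_at_top[OF tendsto_const]
        filterlim_compose[OF sqrt_at_top] filterlim_real_sequentially)
  then have upper: "((\<lambda>n. 1 + 16 / sqrt (real n)) \<longlongrightarrow> 1) ?F"
    by (intro tendsto_mono[OF inf_le1]) simp
  have "(r \<longlongrightarrow> 1) ?F"
  proof (rule tendsto_sandwich[OF _ _ tendsto_const upper])
    show "\<forall>\<^sub>F n in ?F. 1 \<le> r n"
      unfolding eventually_inf_principal by (intro always_eventually) (auto intro: ge)
    show "\<forall>\<^sub>F n in ?F. r n \<le> 1 + 16 / sqrt (real n)"
      unfolding eventually_inf_principal using ab by (intro always_eventually) (auto simp: r_def)
  qed
  moreover have "\<exists>S L \<T>. plane_square L S \<and> square_tiling \<T> S \<and> card \<T> = n \<and>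
        (\<forall>s \<in> side_lengths \<T>. s < L) \<and>
        (\<exists>a b. a < b \<and> side_lengths \<T> = {a, b} \<and> b / a = r n)"
    if "6 \<le> n" "\<not> is_square n" for n
    using ab[OF that] unfolding r_def by (metis of_nat_less_iff)
  ultimately show ?thesis using ge by blast
qed

end
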